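(* Suppose that $f_0=Kw_0$ with $w_0\in\mathcal H_k$ (so that $f_0\in\mathcal H_k$ as well). Then there are constants $C_0$, $C_1$ and $C_2$, all independent of $n$ and $\lambda$, such that for every $\lambda>0$ and every $n\ge1$ $$\mathbb{E}\,\|f_0-\hat f_n\|_k^2\le 2C_0\lambda^2+\frac{4C_1}{\lambda^2 n}+\frac{C_2}{\lambda^3 n}.$$
   Context: $\mathcal X$ is a topological space with its Borel $\sigma$-algebra (typically a subset of $\mathbb R^d$), and $k\colon\mathcal X\times\mathcal X\to\mathbb R$ is a symmetric, positive definite (all Gram matrices positive semidefinite), continuous, measurable and uniformly bounded kernel. $(\mathcal H_k,\|\cdot\|_k)$ is its reproducing kernel Hilbert space, with $\langle k(\cdot,x)\mid k(\cdot,y)\rangle_k=k(x,y)$. $(X,f)$ is a random pair in $\mathcal X\times\mathbb R$ with law $\rho$ and $f\in L^2$ (i.e. $\mathbb E f^2<\infty$). $P(\cdot)=\rho(\cdot\times\mathbb R)$ is the law of $X$, $L^2=L^2(\mathcal X,P)$, and $f_0(x)=\mathbb E(f\mid X=x)$, which is determined $P$-a.e. The operator $K$ is $Kw(x)=\int_{\mathcal X}k(x,y)\,w(y)\,P(dy)$ for $w\in L^2$ (in particular for $w\in\mathcal H_k$). If $f_0=Kw_0$ holds, the version $Kw_0$ of $f_0$ is used. $(X_i,f_i)$, $i=1,\dots,n$, are independent with law $\rho$. For $\lambda>0$ the estimator is $\hat f_n(\cdot)=\frac1n\sum_{i=1}^n k(\cdot,X_i)\,\hat w_i$, where the random weights solve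 $\lambda\hat w_i+\frac1n\sum_{j=1}^n k(X_i,X_j)\hat w_j=f_i$, $i=1,\dots,n$. *)

theory Defs
  imports "HOL-Probability.Probability"
begin

text \<open>Repetitions among the points are allowed; this matches quantifying over all Gram matrices.\<close>

definition psd_kernel :: "('x \<Rightarrow> 'x \<Rightarrow> real) \<Rightarrow> bool" where
  "psd_kernel k \<longleftrightarrow>
     (\<forall>x y. k x y = k y x) \<and>
     (\<forall>(n::nat) (x :: nat \<Rightarrow> 'x) (c :: nat \<Rightarrow> real).
        0 \<le> (\<Sum>i<n. \<Sum>j<n. c i * c j * k (x i) (x j)))"

text \<open>
  A Hilbert space whose elements are real functions on the type \<^typ>\<open>'x\<close>: a carrier set \<open>H\<close>
  together with an inner product \<open>ip\<close>, of which only the values on \<open>H\<close> matter.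
\<close>

definition ip_norm :: "(('x \<Rightarrow> real) \<Rightarrow> ('x \<Rightarrow> real) \<Rightarrow> real) \<Rightarrow> ('x \<Rightarrow> real) \<Rightarrow> real" where
  "ip_norm ip g = sqrt (ip g g)"

locale function_hilbert_space =
  fixes H :: "('x \<Rightarrow> real) set"
    and ip :: "('x \<Rightarrow> real) \<Rightarrow> ('x \<Rightarrow> real) \<Rightarrow> real"
  assumes zero_mem: "(\<lambda>_. 0) \<in> H"
    and add_mem: "\<And>g h. g \<in> H \<Longrightarrow> h \<in> H \<Longrightarrow> (\<lambda>x. g x + h x) \<in> H"
    and scale_mem: "\<And>c g. g \<in> H \<Longrightarrow> (\<lambda>x. c * g x) \<in> H"
    and ip_commute: "\<And>g h. g \<in> H \<Longrightarrow> h \<in> H \<Longrightarrow> ip g h = ip h g"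
    and ip_add_left: "\<And>g g' h. g \<in> H \<Longrightarrow> g' \<in> H \<Longrightarrow> h \<in> H \<Longrightarrow>
          ip (\<lambda>x. g x + g' x) h = ip g h + ip g' h"
    and ip_scale_left: "\<And>c g h. g \<in> H \<Longrightarrow> h \<in> H \<Longrightarrow> ip (\<lambda>x. c * g x) h = c * ip g h"
    and ip_ge_zero: "\<And>g. g \<in> H \<Longrightarrow> 0 \<le> ip g g"
    and ip_eq_zero: "\<And>g. g \<in> H \<Longrightarrow> ip g g = 0 \<Longrightarrow> g = (\<lambda>_. 0)"
    and complete: "\<And>s :: nat \<Rightarrow> 'x \<Rightarrow> real. (\<And>n. s n \<in> H) \<Longrightarrow>
          (\<And>e. e > 0 \<Longrightarrow> \<exists>N. \<forall>m\<ge>N. \<forall>n\<ge>N. ip_norm ip (\<lambda>x. s m x - s n x) < e) \<Longrightarrow>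
          \<exists>g\<in>H. (\<lambda>n. ip_norm ip (\<lambda>x. s n x - g x)) \<longlonglongrightarrow> 0"

text \<open>
  By the Moore--Aronszajn theorem, for a given symmetric positive definite kernel \<open>k\<close> there is exactly
  one \<open>H\<close>, and exactly one \<open>ip\<close> up to its irrelevant values outside \<open>H\<close>, satisfying the following.
\<close>

locale rkhs = function_hilbert_space H ip
  for k :: "'x \<Rightarrow> 'x \<Rightarrow> real"
    and H :: "('x \<Rightarrow> real) set"
    and ip :: "('x \<Rightarrow> real) \<Rightarrow> ('x \<Rightarrow> real) \<Rightarrow> real" +
  assumes kernel_mem: "\<And>x. (\<lambda>t. k t x) \<in> H"
    and reproducing: "\<And>g x. g \<in> H \<Longrightarrow> ip g (\<lambda>t. k t x) = g x"

definition design_law :: "('x::topological_space \<times> real) measure \<Rightarrow> 'x measure" where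
  "design_law \<rho> = distr \<rho> borel fst"

text \<open>
  \<open>f0\<close> is a version of the regression function \<open>x \<mapsto> E (f | X = x)\<close>, for \<open>(X, f)\<close> with
  law \<open>\<rho>\<close>: on the canonical space \<open>\<rho>\<close>, where \<open>X\<close> and \<open>f\<close> are the two projections, \<open>f0 \<circ> X\<close> is a
  version of the conditional expectation of \<open>f\<close> given the \<open>\<sigma>\<close>-algebra generated by \<open>X\<close>.
\<close>

definition regression_function ::
    "('x::topological_space \<times> real) measure \<Rightarrow> ('x \<Rightarrow> real) \<Rightarrow> bool" where
  "regression_function \<rho> f0 \<longleftrightarrow>
     f0 \<in> borel_measurable borel \<and>
     (AE z in \<rho>. f0 (fst z) = real_cond_exp \<rho> (vimage_algebra (space \<rho>) fst borel) snd z)"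

definition kernel_operator ::
    "('x \<Rightarrow> 'x \<Rightarrow> real) \<Rightarrow> 'x measure \<Rightarrow> ('x \<Rightarrow> real) \<Rightarrow> 'x \<Rightarrow> real" where
  "kernel_operator k P w x = (\<integral>y. k x y * w y \<partial>P)"

definition iid_sample ::
    "'w measure \<Rightarrow> ('x::topological_space \<times> real) measure \<Rightarrow> nat
      \<Rightarrow> (nat \<Rightarrow> 'w \<Rightarrow> 'x) \<Rightarrow> (nat \<Rightarrow> 'w \<Rightarrow> real) \<Rightarrow> bool" where
  "iid_sample M \<rho> n X f \<longleftrightarrow>
     prob_space M \<and>
     prob_space.indep_vars M (\<lambda>_. borel \<Otimes>\<^sub>M borel) (\<lambda>i \<omega>. (X i \<omega>, f i \<omega>)) {1..n} \<and>
     (\<forall>i\<in>{1..n}. distr M (borel \<Otimes>\<^sub>M borel) (\<lambda>\<omega>. (X i \<omega>, f i \<omega>)) = \<rho>)"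

text \<open>
  The matrix of the linear system is the sum of \<open>lam\<close> times the identity and a positive semidefinite
  matrix, so for \<open>lam > 0\<close> the weights \<open>w 1, \<dots>, w n\<close> exist and are uniquely determined by the data.
\<close>

definition solves_weights ::
    "('x \<Rightarrow> 'x \<Rightarrow> real) \<Rightarrow> real \<Rightarrow> nat \<Rightarrow> (nat \<Rightarrow> 'x) \<Rightarrow> (nat \<Rightarrow> real) \<Rightarrow> (nat \<Rightarrow> real) \<Rightarrow> bool" where
  "solves_weights k lam n x y w \<longleftrightarrow>
     (\<forall>i\<in>{1..n}. lam * w i + (1 / real n) * (\<Sum>j=1..n. k (x i) (x j) * w j) = y i)"

definition estimator ::
    "('x \<Rightarrow> 'x \<Rightarrow> real) \<Rightarrow> nat \<Rightarrow> (nat \<Rightarrow> 'x) \<Rightarrow> (nat \<Rightarrow> real) \<Rightarrow> 'x \<Rightarrow> real" where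
  "estimator k n x w = (\<lambda>t. (1 / real n) * (\<Sum>i=1..n. k t (x i) * w i))"

end

theory Submission
  imports Defs
begin

text \<open>
  Write \<open>T\<^sub>n g = (1/n) \<Sum>\<^sub>i k(\<cdot>, X\<^sub>i) g(X\<^sub>i)\<close> for the empirical version of the operator \<open>K\<close> on the
  reproducing kernel Hilbert space \<open>H\<close>. It is a positive operator, so \<open>(\<lambda> + T\<^sub>n)\<^sup>-\<^sup>1\<close> has norm at most
  \<open>1/\<lambda>\<close>, and the linear system for the weights says that the estimator \<open>f'\<close> solves
  \<open>(\<lambda> + T\<^sub>n) f' = (1/n) \<Sum>\<^sub>i k(\<cdot>, X\<^sub>i) f\<^sub>i\<close>. With the noise \<open>\<xi> = (1/n) \<Sum>\<^sub>i k(\<cdot>, X\<^sub>i) (f\<^sub>i - f\<^sub>0(X\<^sub>i))\<close>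
  and the sampling error \<open>D = f\<^sub>0 - T\<^sub>n w\<^sub>0\<close>, a short computation turns this into
  \<open>(\<lambda> + T\<^sub>n) (f' - f\<^sub>0 + \<lambda> w\<^sub>0) = \<xi> - \<lambda> D + \<lambda>\<^sup>2 w\<^sub>0\<close>, hence
  \<open>\<parallel>f\<^sub>0 - f'\<parallel> \<le> \<parallel>\<xi>\<parallel>/\<lambda> + \<parallel>D\<parallel> + 2 \<lambda> \<parallel>w\<^sub>0\<parallel>\<close> (lemma \<open>estimator_error_decomposition\<close>).

  Both \<open>\<xi>\<close> and \<open>D\<close> are deviations of an average of \<open>n\<close> independent elements of \<open>H\<close> from its mean:
  the mean of \<open>k(\<cdot>, X) (f - f\<^sub>0(X))\<close> is zero by the definition of \<open>f\<^sub>0\<close> as a conditional expectation,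
  and the mean of \<open>k(\<cdot>, X) w\<^sub>0(X)\<close> is \<open>K w\<^sub>0 = f\<^sub>0\<close>. Therefore \<open>E \<parallel>\<xi>\<parallel>\<^sup>2\<close> and \<open>E \<parallel>D\<parallel>\<^sup>2\<close> are of order
  \<open>1/n\<close> (lemma \<open>kernel_average_variance\<close>). Means in \<open>H\<close> are understood as Riesz representers, which also
  shows that \<open>f\<^sub>0\<close> lies in \<open>H\<close>.

  The random weights are given only implicitly, so the measurability of the error needs an argument:
  the solution of a uniformly coercive and bounded random linear system is the pointwise limit of a
  measurable iteration (lemma \<open>coercive_system_solution_measurable\<close>).
\<close>

section \<open>Hilbert spaces of functions\<close>

context function_hilbert_space
begin

abbreviation nrm :: "('x \<Rightarrow> real) \<Rightarrow> real" where
  "nrm \<equiv> ip_norm ip"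

lemma diff_mem:
  assumes "g \<in> H" "h \<in> H"
  shows "(\<lambda>x. g x - h x) \<in> H"
  using add_mem[OF assms(1) scale_mem[OF assms(2), of "-1"]] by simp

lemma sum_mem:
  assumes "finite I" "\<And>i. i \<in> I \<Longrightarrow> s i \<in> H"
  shows "(\<lambda>x. \<Sum>i\<in>I. s i x) \<in> H"
  using assms by (induction I rule: finite_induct) (auto intro: zero_mem add_mem)

lemma ip_add_right: "g \<in> H \<Longrightarrow> g' \<in> H \<Longrightarrow> h \<in> H \<Longrightarrow> ip h (\<lambda>x. g x + g' x) = ip h g + ip h g'"
  by (simp add: ip_commute[of h] add_mem ip_add_left)

lemma ip_scale_right: "g \<in> H \<Longrightarrow> h \<in> H \<Longrightarrow> ip h (\<lambda>x. c * g x) = c * ip h g"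
  by (simp add: ip_commute[of h] scale_mem ip_scale_left)

lemma ip_zero_left: "h \<in> H \<Longrightarrow> ip (\<lambda>_. 0) h = 0"
  using ip_scale_left[OF zero_mem, of h 0] by simp

lemma ip_diff_left:
  assumes "g \<in> H" "g' \<in> H" "h \<in> H"
  shows "ip (\<lambda>x. g x - g' x) h = ip g h - ip g' h"
  using ip_add_left[OF assms(1) scale_mem[OF assms(2), of "-1"] assms(3)]
    ip_scale_left[OF assms(2,3), of "-1"] by simp

lemma ip_diff_right: "g \<in> H \<Longrightarrow> g' \<in> H \<Longrightarrow> h \<in> H \<Longrightarrow> ip h (\<lambda>x. g x - g' x) = ip h g - ip h g'"
  by (simp add: ip_commute[of h] diff_mem ip_diff_left)

lemma ip_sum_left:
  assumes "finite I" "\<And>i. i \<in> I \<Longrightarrow> s i \<in> H" "h \<in> H"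
  shows "ip (\<lambda>x. \<Sum>i\<in>I. s i x) h = (\<Sum>i\<in>I. ip (s i) h)"
  using assms by (induction I rule: finite_induct) (auto simp: ip_zero_left ip_add_left sum_mem)

lemma nrm_nonneg: "g \<in> H \<Longrightarrow> 0 \<le> nrm g"
  by (simp add: ip_norm_def ip_ge_zero)

lemma nrm_square: "g \<in> H \<Longrightarrow> (nrm g)\<^sup>2 = ip g g"
  by (simp add: ip_norm_def ip_ge_zero)

lemma ip_self_add_scaled:
  assumes "g \<in> H" "h \<in> H"
  shows "ip (\<lambda>x. g x + t * h x) (\<lambda>x. g x + t * h x) = ip g g + 2 * t * ip g h + t\<^sup>2 * ip h h"
  using assms ip_commute[OF assms]
  by (simp add: add_mem scale_mem ip_add_left ip_add_right ip_scale_left ip_scale_right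
      algebra_simps power2_eq_square)

text \<open>The quadratic \<open>t \<mapsto> \<parallel>g + t h\<parallel>\<^sup>2\<close> is nonnegative, so its discriminant is nonpositive.\<close>

lemma Cauchy_Schwarz:
  assumes "g \<in> H" "h \<in> H"
  shows "\<bar>ip g h\<bar> \<le> nrm g * nrm h"
proof -
  have "(ip g h)\<^sup>2 \<le> ip g g * ip h h"
  proof (cases "ip h h = 0")
    case True
    then have "h = (\<lambda>_. 0)" using ip_eq_zero assms by blast
    then show ?thesis using ip_zero_left[OF zero_mem] ip_zero_left[OF assms(1)] ip_commute[OF assms] by simp
  next
    case False
    then have pos: "ip h h > 0" using ip_ge_zero[OF assms(2)] by simp
    have "0 \<le> ip g g + 2 * (- ip g h / ip h h) * ip g h + (- ip g h / ip h h)\<^sup>2 * ip h h"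
      using ip_ge_zero[OF add_mem[OF assms(1) scale_mem[OF assms(2)]]]
      by (simp only: ip_self_add_scaled[OF assms])
    also have "\<dots> = ip g g - (ip g h)\<^sup>2 / ip h h"
      using pos by (simp add: field_simps power2_eq_square)
    finally show ?thesis using pos by (simp add: field_simps)
  qed
  then have "sqrt ((ip g h)\<^sup>2) \<le> sqrt (ip g g * ip h h)" by (rule real_sqrt_le_mono)
  then show ?thesis by (simp add: ip_norm_def real_sqrt_mult)
qed

lemma nrm_triangle:
  assumes "g \<in> H" "h \<in> H"
  shows "nrm (\<lambda>x. g x + h x) \<le> nrm g + nrm h"
proof -
  have "(nrm (\<lambda>x. g x + h x))\<^sup>2 = (nrm g)\<^sup>2 + 2 * ip g h + (nrm h)\<^sup>2"
    using ip_self_add_scaled[OF assms, of 1] by (simp add: nrm_square add_mem assms)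
  also have "\<dots> \<le> (nrm g + nrm h)\<^sup>2"
    using Cauchy_Schwarz[OF assms] by (simp add: power2_sum)
  finally show ?thesis
    by (rule power2_le_imp_le) (intro add_nonneg_nonneg nrm_nonneg assms)
qed

lemma nrm_scale: "g \<in> H \<Longrightarrow> nrm (\<lambda>x. c * g x) = \<bar>c\<bar> * nrm g"
  by (simp add: ip_norm_def ip_scale_left ip_scale_right scale_mem real_sqrt_mult)

lemma nrm_triangle_diff:
  assumes "g \<in> H" "h \<in> H"
  shows "nrm (\<lambda>x. g x - h x) \<le> nrm g + nrm h"
  using nrm_triangle[OF assms(1) scale_mem[OF assms(2), of "-1"]] nrm_scale[OF assms(2), of "-1"]
  by simp

text \<open>
  The representer minimises \<open>J g = \<parallel>g\<parallel>\<^sup>2 - 2 L g\<close>. By the parallelogram law, applied to two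
  near-minimisers and their midpoint, a minimising sequence is Cauchy; its limit \<open>g\<close> satisfies
  \<open>0 \<le> 2 t (\<langle>g, h\<rangle> - L h) + t\<^sup>2 \<parallel>h\<parallel>\<^sup>2\<close> for all real \<open>t\<close>, which forces \<open>\<langle>g, h\<rangle> = L h\<close>.
\<close>

theorem Riesz_representation:
  assumes L_add: "\<And>g h. g \<in> H \<Longrightarrow> h \<in> H \<Longrightarrow> L (\<lambda>x. g x + h x) = L g + L h"
    and L_scale: "\<And>c g. g \<in> H \<Longrightarrow> L (\<lambda>x. c * g x) = c * L g"
    and L_bounded: "\<And>g. g \<in> H \<Longrightarrow> \<bar>L g\<bar> \<le> c * nrm g"
  obtains g where "g \<in> H" "\<And>h. h \<in> H \<Longrightarrow> ip g h = L h"
proof -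
  define J where "J g = ip g g - 2 * L g" for g
  have J_lower: "- c\<^sup>2 \<le> J g" if "g \<in> H" for g
  proof -
    have "0 \<le> (nrm g - c)\<^sup>2" by simp
    then show ?thesis using L_bounded[OF that] nrm_square[OF that]
      by (simp add: J_def power2_diff mult_ac)
  qed
  define m where "m = Inf (J ` H)"
  have bdd: "bdd_below (J ` H)" using J_lower by (auto intro!: bdd_belowI2)
  have m_le: "m \<le> J g" if "g \<in> H" for g
    unfolding m_def by (rule cInf_lower) (use that bdd in auto)
  have "\<exists>g\<in>H. J g < m + inverse (real (Suc n))" for n
  proof -
    have "Inf (J ` H) < m + inverse (real (Suc n))" by (simp add: m_def)
    then show ?thesis using cInf_lessD[of "J ` H"] zero_mem by blast
  qed
  then obtain s where s: "\<And>n. s n \<in> H" and J_s: "\<And>n. J (s n) < m + inverse (real (Suc n))"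
    by metis
  have parallelogram: "ip (\<lambda>x. g x - h x) (\<lambda>x. g x - h x)
      = 2 * J g + 2 * J h - 4 * J (\<lambda>x. (1/2) * (g x + h x))"
    if "g \<in> H" "h \<in> H" for g h
    using that ip_commute[OF that]
    by (simp only: J_def ip_diff_left ip_diff_right ip_scale_left ip_scale_right ip_add_left
        ip_add_right L_add L_scale diff_mem scale_mem add_mem) (simp add: algebra_simps)
  have close: "ip (\<lambda>x. s i x - s j x) (\<lambda>x. s i x - s j x)
      \<le> 2 * inverse (real (Suc i)) + 2 * inverse (real (Suc j))" for i j
    using parallelogram[OF s s, of i j] J_s[of i] J_s[of j]
      m_le[OF scale_mem[OF add_mem[OF s[of i] s[of j]], of "1/2"]] by linarith
  have "\<exists>N. \<forall>i\<ge>N. \<forall>j\<ge>N. ip_norm ip (\<lambda>x. s i x - s j x) < e" if "e > 0" for e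
  proof -
    obtain N where N: "inverse (real (Suc N)) < e\<^sup>2 / 4"
      using reals_Archimedean[of "e\<^sup>2/4"] \<open>e > 0\<close> by auto
    have "ip_norm ip (\<lambda>x. s i x - s j x) < e" if "i \<ge> N" "j \<ge> N" for i j
    proof -
      have "inverse (real (Suc i)) \<le> inverse (real (Suc N))"
        "inverse (real (Suc j)) \<le> inverse (real (Suc N))" using that by auto
      then have "ip (\<lambda>x. s i x - s j x) (\<lambda>x. s i x - s j x) < e\<^sup>2"
        using close[of i j] N by linarith
      then show ?thesis unfolding ip_norm_def
        using \<open>e > 0\<close> real_sqrt_less_mono[of _ "e\<^sup>2"] by simp
    qed
    then show ?thesis by blast
  qed
  from complete[OF s this]
  obtain g where g: "g \<in> H" and lim: "(\<lambda>n. nrm (\<lambda>x. s n x - g x)) \<longlonglongrightarrow> 0" ..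
  have "ip g h = L h" if h: "h \<in> H" for h
  proof -
    have ip_lim: "(\<lambda>n. ip (s n) h) \<longlonglongrightarrow> ip g h"
    proof (rule LIM_zero_cancel, rule Lim_null_comparison)
      show "\<forall>\<^sub>F n in sequentially. norm (ip (s n) h - ip g h) \<le> nrm (\<lambda>x. s n x - g x) * nrm h"
        using Cauchy_Schwarz[OF diff_mem[OF s g] h] by (simp add: ip_diff_left s g h)
      show "(\<lambda>n. nrm (\<lambda>x. s n x - g x) * nrm h) \<longlonglongrightarrow> 0"
        using tendsto_mult_right[OF lim, of "nrm h"] by simp
    qed
    define a where "a = ip g h - L h"
    have quadratic: "0 \<le> 2 * t * a + t\<^sup>2 * ip h h" for t
    proof -
      have "0 \<le> inverse (real (Suc n)) + 2 * t * (ip (s n) h - L h) + t\<^sup>2 * ip h h" for n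
      proof -
        have "J (\<lambda>x. s n x + t * h x) = J (s n) + 2 * t * (ip (s n) h - L h) + t\<^sup>2 * ip h h"
          by (simp add: J_def ip_self_add_scaled s h L_add L_scale scale_mem algebra_simps)
        then show ?thesis
          using m_le[OF add_mem[OF s scale_mem[OF h]], of n t] J_s[of n] by linarith
      qed
      moreover have "(\<lambda>n. inverse (real (Suc n)) + 2 * t * (ip (s n) h - L h) + t\<^sup>2 * ip h h)
          \<longlonglongrightarrow> 0 + 2 * t * a + t\<^sup>2 * ip h h"
        unfolding a_def by (intro tendsto_intros LIMSEQ_inverse_real_of_nat ip_lim)
      ultimately show ?thesis using LIMSEQ_le_const by fastforce
    qed
    have "a = 0"
    proof (rule ccontr)
      assume "a \<noteq> 0"
      have "ip h h \<ge> 0" by (rule ip_ge_zero[OF h])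
      (* for h other than zero the best t is - a / ip h h; adding 1 keeps the denominator positive
         for h = 0 as well *)
      define t where "t = - a / (ip h h + 1)"
      have "2 * t * a + t\<^sup>2 * ip h h = - (a\<^sup>2 / (ip h h + 1)\<^sup>2) * (ip h h + 2)"
        using \<open>ip h h \<ge> 0\<close> unfolding t_def
        by (simp add: divide_simps power2_eq_square) (simp add: algebra_simps)
      also have "\<dots> < 0" using \<open>a \<noteq> 0\<close> \<open>ip h h \<ge> 0\<close> by (simp add: mult_pos_pos)
      finally show False using quadratic[of t] by simp
    qed
    then show ?thesis by (simp add: a_def)
  qed
  with g show ?thesis by (rule that)
qed

end

section \<open>The estimator as a regularised inverse problem\<close>

context rkhs
begin

lemma kernel_sym: "k x y = k y x"
  using reproducing[OF kernel_mem[of x], of y] reproducing[OF kernel_mem[of y], of x]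
    ip_commute[OF kernel_mem[of x] kernel_mem[of y]] by simp

text \<open>
  Every finite combination of kernel sections is an estimator for suitable weights. In particular,
  \<open>estimator k n x (\<lambda>i. g (x i))\<close> is the empirical kernel operator \<open>T\<^sub>n\<close> applied to \<open>g\<close>.
\<close>

lemma estimator_eq: "estimator k n x c = (\<lambda>t. (1 / real n) * (\<Sum>i=1..n. c i * k t (x i)))"
  by (simp add: estimator_def mult.commute)

lemma weighted_section_mem: "(\<lambda>t. \<Sum>i=1..n::nat. c i * k t (x i)) \<in> H"
  by (intro sum_mem scale_mem kernel_mem) simp

lemma estimator_mem: "estimator k n x c \<in> H"
  unfolding estimator_eq by (intro scale_mem weighted_section_mem)

lemma ip_estimator:
  assumes "g \<in> H"
  shows "ip (estimator k n x c) g = (1 / real n) * (\<Sum>i=1..n. c i * g (x i))"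
proof -
  have "ip (\<lambda>t. c i * k t (x i)) g = c i * g (x i)" for i
    using ip_scale_left[OF kernel_mem assms] reproducing[OF assms] ip_commute[OF kernel_mem assms]
    by simp
  then have "ip (\<lambda>t. \<Sum>i=1..n. c i * k t (x i)) g = (\<Sum>i=1..n. c i * g (x i))"
    using ip_sum_left[of "{1..n}" "\<lambda>i t. c i * k t (x i)" g] assms kernel_mem scale_mem by simp
  then show ?thesis
    unfolding estimator_eq by (simp only: ip_scale_left[OF weighted_section_mem assms])
qed

lemma ip_estimator_self:
  "ip (estimator k n x c) (estimator k n x c)
    = (1 / (real n)\<^sup>2) * (\<Sum>i=1..n. \<Sum>j=1..n. c i * c j * k (x i) (x j))"
  unfolding ip_estimator[OF estimator_mem]
  by (simp add: estimator_def sum_distrib_left sum_divide_distrib power2_eq_square mult_ac)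

text \<open>The quadratic form is \<open>n\<^sup>2\<close> times the squared norm of the estimator with weights \<open>v\<close>.\<close>

lemma gram_psd: "0 \<le> (\<Sum>i=1..n::nat. v i * (\<Sum>j=1..n. k (x i) (x j) * v j))"
proof (cases "n = 0")
  case False
  have "0 \<le> (real n)\<^sup>2 * ip (estimator k n x v) (estimator k n x v)"
    using ip_ge_zero[OF estimator_mem] by simp
  also have "\<dots> = (\<Sum>i=1..n. v i * (\<Sum>j=1..n. k (x i) (x j) * v j))"
    using False by (simp add: ip_estimator_self sum_distrib_left mult_ac)
  finally show ?thesis .
qed simp

lemma estimator_error_square:
  assumes "g \<in> H"
  shows "(nrm (\<lambda>t. g t - estimator k n x c t))\<^sup>2
    = ip g g - (2 / real n) * (\<Sum>i=1..n. c i * g (x i))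
      + (1 / (real n)\<^sup>2) * (\<Sum>i=1..n. \<Sum>j=1..n. c i * c j * k (x i) (x j))"
proof -
  note mem = assms estimator_mem[of n x c]
  have "(nrm (\<lambda>t. g t - estimator k n x c t))\<^sup>2
      = ip g g - 2 * ip (estimator k n x c) g + ip (estimator k n x c) (estimator k n x c)"
    using mem ip_commute[OF mem] by (simp add: nrm_square diff_mem ip_diff_left ip_diff_right)
  then show ?thesis by (simp add: ip_estimator[OF assms] ip_estimator_self)
qed

lemma eval_bound:
  assumes "g \<in> H" "\<And>x. k x x \<le> B"
  shows "\<bar>g x\<bar> \<le> sqrt B * nrm g"
proof -
  have "nrm (\<lambda>t. k t x) \<le> sqrt B"
    using assms(2)[of x] reproducing[OF kernel_mem] by (simp add: ip_norm_def)
  then have "nrm g * nrm (\<lambda>t. k t x) \<le> nrm g * sqrt B"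
    using nrm_nonneg[OF assms(1)] by (rule mult_left_mono)
  then show ?thesis
    using Cauchy_Schwarz[OF assms(1) kernel_mem, of x] reproducing[OF assms(1)]
    by (simp add: mult.commute)
qed

text \<open>
  Pairing \<open>lam u + T\<^sub>n u\<close> with \<open>u\<close>, where \<open>T\<^sub>n\<close> is the empirical kernel operator, gives
  \<open>lam \<parallel>u\<parallel>\<^sup>2\<close> plus the nonnegative average of the \<open>u (x i)\<^sup>2\<close>. So \<open>(lam + T\<^sub>n)\<^sup>-\<^sup>1\<close> has norm at most
  \<open>1 / lam\<close>.
\<close>

lemma regularised_inverse_bound:
  assumes "u \<in> H" "lam > 0"
  shows "lam * nrm u \<le> nrm (\<lambda>t. lam * u t + estimator k n x (\<lambda>i. u (x i)) t)"
proof (cases "nrm u = 0")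
  case True
  then show ?thesis using assms by (simp add: nrm_nonneg add_mem scale_mem estimator_mem)
next
  case False
  then have pos: "nrm u > 0" using nrm_nonneg[OF assms(1)] by simp
  let ?r = "\<lambda>t. lam * u t + estimator k n x (\<lambda>i. u (x i)) t"
  have r: "?r \<in> H" using assms by (simp add: add_mem scale_mem estimator_mem)
  have "0 \<le> (1 / real n) * (\<Sum>i=1..n. u (x i) * u (x i))"
    by (simp add: sum_nonneg)
  then have "lam * (nrm u)\<^sup>2 \<le> ip ?r u"
    using assms
    by (simp add: nrm_square ip_add_left ip_scale_left scale_mem estimator_mem ip_estimator)
  also have "\<dots> \<le> nrm ?r * nrm u"
    using Cauchy_Schwarz[OF r assms(1)] by simp
  finally show ?thesis using pos by (simp add: power2_eq_square)
qed

text \<open>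
  The system for the weights says that \<open>f' = estimator k n x w\<close> solves
  \<open>(lam + T\<^sub>n) f' = estimator k n x y\<close>. Hence \<open>u = f' - f0 + lam w0\<close> satisfies
  \<open>(lam + T\<^sub>n) u = \<xi> - lam D + lam\<^sup>2 w0\<close>, with the noise \<open>\<xi>\<close> and the sampling error
  \<open>D = f0 - T\<^sub>n w0\<close>; the correction \<open>lam w0\<close> turns the bias \<open>lam f0\<close> into \<open>lam D\<close>, whose
  factor \<open>lam\<close> cancels the norm \<open>1 / lam\<close> of the inverse.
\<close>

lemma estimator_error_decomposition:
  assumes f0: "f0 \<in> H" and w0: "w0 \<in> H" and lam: "lam > 0"
    and w: "solves_weights k lam n x y w"
  shows "nrm (\<lambda>t. f0 t - estimator k n x w t)
    \<le> nrm (estimator k n x (\<lambda>i. y i - f0 (x i))) / lam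
      + nrm (\<lambda>t. f0 t - estimator k n x (\<lambda>i. w0 (x i)) t) + 2 * lam * nrm w0"
proof -
  define \<xi> where "\<xi> = estimator k n x (\<lambda>i. y i - f0 (x i))"
  define D where "D t = f0 t - estimator k n x (\<lambda>i. w0 (x i)) t" for t
  define e where "e t = f0 t - estimator k n x w t" for t
  define u where "u t = lam * w0 t - e t" for t
  have \<xi>: "\<xi> \<in> H" unfolding \<xi>_def by (rule estimator_mem)
  have D: "D \<in> H" unfolding D_def by (intro diff_mem f0 estimator_mem)
  have e: "e \<in> H" unfolding e_def by (intro diff_mem f0 estimator_mem)
  have u: "u \<in> H" unfolding u_def by (intro diff_mem scale_mem w0 e)
  have lin: "estimator k n x (\<lambda>i. a * c i + b * d i + d' i) t
      = a * estimator k n x c t + b * estimator k n x d t + estimator k n x d' t" for a b c d d' t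
    by (simp add: estimator_def sum.distrib sum_distrib_left algebra_simps)
  have cong: "estimator k n x c = estimator k n x d" if "\<And>i. i \<in> {1..n} \<Longrightarrow> c i = d i" for c d
    unfolding estimator_def using that by (intro ext arg_cong2[where f="(*)"] refl sum.cong) auto
  have "estimator k n x (\<lambda>i. u (x i))
      = estimator k n x (\<lambda>i. lam * w0 (x i) + (- lam) * w i + (y i - f0 (x i)))"
  proof (rule cong)
    fix i assume "i \<in> {1..n}"
    then have "lam * w i + estimator k n x w (x i) = y i"
      using w by (simp add: solves_weights_def estimator_def)
    then show "u (x i) = lam * w0 (x i) + (- lam) * w i + (y i - f0 (x i))"
      by (simp add: u_def e_def)
  qed
  then have "lam * u t + estimator k n x (\<lambda>i. u (x i)) t = (\<xi> t - lam * D t) + lam\<^sup>2 * w0 t" for t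
    by (simp only: lin \<xi>_def D_def u_def e_def) (simp add: algebra_simps power2_eq_square)
  then have "lam * nrm u \<le> nrm (\<lambda>t. (\<xi> t - lam * D t) + lam\<^sup>2 * w0 t)"
    using regularised_inverse_bound[OF u lam, of n x] by simp
  also have "\<dots> \<le> nrm (\<lambda>t. \<xi> t - lam * D t) + nrm (\<lambda>t. lam\<^sup>2 * w0 t)"
    by (intro nrm_triangle diff_mem scale_mem \<xi> D w0)
  also have "\<dots> \<le> nrm \<xi> + lam * nrm D + lam\<^sup>2 * nrm w0"
    using nrm_triangle_diff[OF \<xi> scale_mem[OF D], of lam] lam
    by (simp add: nrm_scale D w0)
  finally have "nrm u \<le> nrm \<xi> / lam + nrm D + lam * nrm w0"
    using lam by (simp add: field_simps power2_eq_square)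
  moreover have "nrm e \<le> lam * nrm w0 + nrm u"
  proof -
    have "e = (\<lambda>t. lam * w0 t - u t)" by (simp add: u_def fun_eq_iff)
    then show ?thesis
      using nrm_triangle_diff[OF scale_mem[OF w0] u, of lam] lam by (simp add: nrm_scale w0)
  qed
  ultimately show ?thesis
    by (simp add: \<xi>_def e_def[abs_def] D_def[abs_def])
qed

end

section \<open>Measurability\<close>

text \<open>
  \<open>|g y - g x|\<close> is at most \<open>\<parallel>g\<parallel>\<close> times the distance \<open>sqrt (k y y - 2 k y x + k x x)\<close> of the two
  kernel sections, and this distance tends to zero as \<open>y\<close> tends to \<open>x\<close>.
\<close>

lemma rkhs_continuous:
  fixes k :: "'x::topological_space \<Rightarrow> 'x \<Rightarrow> real"
  assumes "rkhs k H ip" "continuous_on UNIV (\<lambda>(x, y). k x y)" "g \<in> H"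
  shows "continuous_on UNIV g"
proof -
  interpret rkhs k H ip by fact
  have k_cont: "continuous_on UNIV (\<lambda>y. k (a y) (b y))"
    if "continuous_on UNIV a" "continuous_on UNIV b" for a b :: "'x \<Rightarrow> 'x"
    using continuous_on_compose2[OF assms(2) continuous_on_Pair[OF that]] by simp
  have "(g \<longlongrightarrow> g x) (at x)" for x
  proof (rule LIM_zero_cancel, rule Lim_null_comparison)
    have "norm (g y - g x) \<le> nrm g * sqrt (k y y - 2 * k y x + k x x)" for y
    proof -
      have "g y - g x = ip g (\<lambda>t. k t y - k t x)"
        using reproducing[OF assms(3)] ip_diff_right[OF kernel_mem kernel_mem assms(3)] by simp
      moreover have "nrm (\<lambda>t. k t y - k t x) = sqrt (k y y - 2 * k y x + k x x)"
        using kernel_sym[of x y]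
        by (simp add: ip_norm_def ip_diff_left ip_diff_right kernel_mem diff_mem reproducing)
      ultimately show ?thesis
        using Cauchy_Schwarz[OF assms(3) diff_mem[OF kernel_mem kernel_mem], of y x] by simp
    qed
    then show "\<forall>\<^sub>F y in at x. norm (g y - g x) \<le> nrm g * sqrt (k y y - 2 * k y x + k x x)"
      by simp
    have "continuous_on UNIV (\<lambda>y. nrm g * sqrt (k y y - 2 * k y x + k x x))"
      by (intro continuous_intros k_cont)
    then show "((\<lambda>y. nrm g * sqrt (k y y - 2 * k y x + k x x)) \<longlongrightarrow> 0) (at x)"
      using kernel_sym by (auto simp: continuous_on_def dest!: spec[of _ x])
  qed
  then show ?thesis by (simp add: continuous_on_def)
qed

text \<open>
  The damped iteration \<open>z \<leftarrow> z - \<eta> (A z - y)\<close> is measurable in every step and converges pointwise to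
  the solution: with \<open>|A v|\<^sup>2 \<le> L |v|\<^sup>2\<close> and \<open>c |v|\<^sup>2 \<le> \<langle>v, A v\<rangle>\<close>, the choice \<open>\<eta> = c / L\<close> shrinks the squared
  error by the factor \<open>1 - c\<^sup>2 / L\<close> in each step.
\<close>

lemma coercive_system_solution_measurable:
  fixes A :: "'i \<Rightarrow> 'i \<Rightarrow> 'w \<Rightarrow> real"
  assumes I: "finite I" "i0 \<in> I"
    and A_meas: "\<And>i j. i \<in> I \<Longrightarrow> j \<in> I \<Longrightarrow> A i j \<in> borel_measurable M"
    and y_meas: "\<And>i. i \<in> I \<Longrightarrow> y i \<in> borel_measurable M"
    and A_bound: "\<And>i j \<omega>. i \<in> I \<Longrightarrow> j \<in> I \<Longrightarrow> \<bar>A i j \<omega>\<bar> \<le> b"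
    and coercive: "c > 0" "\<And>v \<omega>. c * (\<Sum>i\<in>I. (v i)\<^sup>2) \<le> (\<Sum>i\<in>I. v i * (\<Sum>j\<in>I. A i j \<omega> * v j))"
    and solution: "\<And>i \<omega>. i \<in> I \<Longrightarrow> \<omega> \<in> space M \<Longrightarrow> (\<Sum>j\<in>I. A i j \<omega> * w j \<omega>) = y i \<omega>"
  shows "w i0 \<in> borel_measurable M"
proof -
  define L where "L = (b * card I)\<^sup>2 + c\<^sup>2"
  define \<eta> where "\<eta> = c / L"
  define q where "q = 1 - c\<^sup>2 / L"
  have L: "L > 0" "c\<^sup>2 \<le> L" using coercive(1) by (auto simp: L_def add_nonneg_pos)
  have q: "0 \<le> q" "q < 1" using L coercive(1) by (auto simp: q_def)
  define z where "z = rec_nat (\<lambda>i \<omega>. 0) (\<lambda>_ z i \<omega>. z i \<omega> - \<eta> * ((\<Sum>j\<in>I. A i j \<omega> * z j \<omega>) - y i \<omega>))"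
  have z_0: "z 0 i \<omega> = 0"
    and z_Suc: "z (Suc t) i \<omega> = z t i \<omega> - \<eta> * ((\<Sum>j\<in>I. A i j \<omega> * z t j \<omega>) - y i \<omega>)" for t i \<omega>
    by (simp_all add: z_def)
  have z_meas: "z t i \<in> borel_measurable M" if "i \<in> I" for t i
    using that
  proof (induction t arbitrary: i)
    case (Suc t)
    then have [measurable]: "\<And>j. j \<in> I \<Longrightarrow> z t j \<in> borel_measurable M" "y i \<in> borel_measurable M"
      "\<And>j. j \<in> I \<Longrightarrow> A i j \<in> borel_measurable M"
      using A_meas y_meas by auto
    have "(\<lambda>\<omega>. z t i \<omega> - \<eta> * ((\<Sum>j\<in>I. A i j \<omega> * z t j \<omega>) - y i \<omega>)) \<in> borel_measurable M"
      using Suc.prems by measurable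
    then show ?case by (simp add: z_Suc[abs_def])
  qed (simp add: z_0[abs_def])
  have "(\<lambda>t. z t i0 \<omega>) \<longlonglongrightarrow> w i0 \<omega>" if \<omega>: "\<omega> \<in> space M" for \<omega>
  proof -
    define r where "r t i = z t i \<omega> - w i \<omega>" for t i
    define E where "E t = (\<Sum>i\<in>I. (r t i)\<^sup>2)" for t
    define Ar where "Ar t i = (\<Sum>j\<in>I. A i j \<omega> * r t j)" for t i
    have r_Suc: "r (Suc t) i = r t i - \<eta> * Ar t i" if "i \<in> I" for t i
      using solution[OF that \<omega>]
      by (simp add: r_def z_Suc Ar_def right_diff_distrib sum_subtractf)
    have Ar_le: "(\<Sum>i\<in>I. (Ar t i)\<^sup>2) \<le> L * E t" for t
    proof -
      have "(Ar t i)\<^sup>2 \<le> (real (card I) * b\<^sup>2) * E t" if "i \<in> I" for i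
      proof -
        have "(Ar t i)\<^sup>2 \<le> real (card I) * (\<Sum>j\<in>I. (A i j \<omega> * r t j)\<^sup>2)"
          unfolding Ar_def using sum_squared_le_sum_of_squares[of "\<lambda>j. A i j \<omega> * r t j" I] by (simp add: mult.commute)
        also have "\<dots> \<le> real (card I) * (\<Sum>j\<in>I. b\<^sup>2 * (r t j)\<^sup>2)"
        proof (intro mult_left_mono sum_mono)
          fix j assume "j \<in> I"
          then have "(A i j \<omega>)\<^sup>2 \<le> b\<^sup>2"
            using A_bound[OF \<open>i \<in> I\<close>, of j \<omega>] by (simp add: abs_le_square_iff[symmetric])
          then show "(A i j \<omega> * r t j)\<^sup>2 \<le> b\<^sup>2 * (r t j)\<^sup>2"
            by (simp add: power_mult_distrib mult_right_mono)
        qed simp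
        also have "\<dots> = (real (card I) * b\<^sup>2) * E t" by (simp add: E_def sum_distrib_left mult_ac)
        finally show ?thesis .
      qed
      then have "(\<Sum>i\<in>I. (Ar t i)\<^sup>2) \<le> (\<Sum>i\<in>I. (real (card I) * b\<^sup>2) * E t)" by (rule sum_mono)
      also have "\<dots> = (b * card I)\<^sup>2 * E t" by (simp add: power2_eq_square mult_ac)
      also have "\<dots> \<le> L * E t" by (intro mult_right_mono) (auto simp: L_def E_def sum_nonneg)
      finally show ?thesis .
    qed
    (* expand |r - eta A r|^2 and insert both bounds on A *)
    have E_Suc: "E (Suc t) \<le> q * E t" for t
    proof -
      have "E (Suc t) = (\<Sum>i\<in>I. (r t i)\<^sup>2 - 2 * \<eta> * (r t i * Ar t i) + \<eta>\<^sup>2 * (Ar t i)\<^sup>2)"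
        unfolding E_def by (intro sum.cong refl) (simp add: r_Suc power2_eq_square algebra_simps)
      also have "\<dots> = E t - 2 * \<eta> * (\<Sum>i\<in>I. r t i * Ar t i) + \<eta>\<^sup>2 * (\<Sum>i\<in>I. (Ar t i)\<^sup>2)"
        by (simp add: E_def sum.distrib sum_subtractf sum_distrib_left)
      also have "\<dots> \<le> E t - 2 * \<eta> * (c * E t) + \<eta>\<^sup>2 * (L * E t)"
      proof -
        have "c * E t \<le> (\<Sum>i\<in>I. r t i * Ar t i)" unfolding E_def Ar_def by (rule coercive(2))
        then have "2 * \<eta> * (c * E t) \<le> 2 * \<eta> * (\<Sum>i\<in>I. r t i * Ar t i)"
          using L coercive(1) by (intro mult_left_mono) (auto simp: \<eta>_def)
        moreover have "\<eta>\<^sup>2 * (\<Sum>i\<in>I. (Ar t i)\<^sup>2) \<le> \<eta>\<^sup>2 * (L * E t)"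
          by (intro mult_left_mono Ar_le) auto
        ultimately show ?thesis by linarith
      qed
      also have "\<dots> = q * E t"
        using L by (simp add: q_def \<eta>_def field_simps power2_eq_square)
      finally show ?thesis .
    qed
    have E_le: "E t \<le> q ^ t * E 0" for t
    proof (induction t)
      case (Suc t)
      have "E (Suc t) \<le> q * (q ^ t * E 0)"
        using E_Suc[of t] mult_left_mono[OF Suc q(1)] by linarith
      then show ?case by simp
    qed simp
    have "(\<lambda>t. sqrt (q ^ t * E 0)) \<longlonglongrightarrow> sqrt (0 * E 0)"
      using q by (intro tendsto_intros LIMSEQ_realpow_zero)
    then have bound_lim: "(\<lambda>t. sqrt (q ^ t * E 0)) \<longlonglongrightarrow> 0" by simp
    have r_le: "norm (r t i0) \<le> sqrt (q ^ t * E 0)" for t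
    proof -
      have "(r t i0)\<^sup>2 \<le> E t"
        unfolding E_def using I by (intro member_le_sum) auto
      then have "sqrt ((r t i0)\<^sup>2) \<le> sqrt (q ^ t * E 0)"
        using E_le[of t] by (intro real_sqrt_le_mono) linarith
      then show ?thesis by simp
    qed
    have "(\<lambda>t. r t i0) \<longlonglongrightarrow> 0"
      by (rule Lim_null_comparison[OF always_eventually bound_lim]) (use r_le in blast)
    then show ?thesis unfolding r_def by (rule LIM_zero_cancel)
  qed
  then show ?thesis using z_meas[OF I(2)] by (rule borel_measurable_LIMSEQ_real)
qed

section \<open>Random designs\<close>

text \<open>
  Measurability of the members of \<open>H\<close> is an assumption here; for a continuous kernel it follows from
  lemma \<open>rkhs_continuous\<close>.
\<close>

locale kernel_design = rkhs k H ip + law: prob_space \<rho>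
  for k :: "'x::topological_space \<Rightarrow> 'x \<Rightarrow> real"
    and H :: "('x \<Rightarrow> real) set"
    and ip :: "('x \<Rightarrow> real) \<Rightarrow> ('x \<Rightarrow> real) \<Rightarrow> real"
    and \<rho> :: "('x \<times> real) measure" +
  fixes B :: real
  assumes k_measurable [measurable]: "(\<lambda>(x, y). k x y) \<in> borel_measurable (borel \<Otimes>\<^sub>M borel)"
    and k_bound: "\<And>x y. \<bar>k x y\<bar> \<le> B"
    and mem_measurable: "\<And>g. g \<in> H \<Longrightarrow> g \<in> borel_measurable borel"
    and law_sets [measurable_cong]: "sets \<rho> = sets (borel \<Otimes>\<^sub>M borel)"
begin

lemma mem_bound: "g \<in> H \<Longrightarrow> \<bar>g x\<bar> \<le> sqrt B * nrm g"
  using k_bound by (intro eval_bound) (auto intro: order_trans[OF abs_ge_self])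

lemma integrable_times_mem:
  assumes "integrable \<rho> h" "g \<in> H"
  shows "integrable \<rho> (\<lambda>z. h z * g (fst z))"
proof (rule Bochner_Integration.integrable_bound)
  show "integrable \<rho> (\<lambda>z. h z * (sqrt B * nrm g))" using assms(1) by simp
  have [measurable]: "h \<in> borel_measurable \<rho>" "g \<in> borel_measurable borel"
    using assms mem_measurable by auto
  show "(\<lambda>z. h z * g (fst z)) \<in> borel_measurable \<rho>" by measurable
  have "\<bar>g x\<bar> \<le> \<bar>sqrt B * nrm g\<bar>" for x using mem_bound[OF assms(2), of x] by linarith
  then show "AE z in \<rho>. norm (h z * g (fst z)) \<le> norm (h z * (sqrt B * nrm g))"
    unfolding real_norm_def abs_mult[of "h _"] by (intro AE_I2 mult_left_mono) auto
qed

text \<open>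
  The Riesz representer of \<open>g \<mapsto> E (h(X, f) g(X))\<close> stands for the \<open>H\<close>-valued mean of the
  random kernel section \<open>h(X, f) k(\<cdot>, X)\<close>.
\<close>

lemma mean_embedding:
  assumes h: "integrable \<rho> h"
  obtains \<mu> where "\<mu> \<in> H" "\<And>g. g \<in> H \<Longrightarrow> ip \<mu> g = (\<integral>z. h z * g (fst z) \<partial>\<rho>)"
proof (rule Riesz_representation[where L = "\<lambda>g. \<integral>z. h z * g (fst z) \<partial>\<rho>"
      and c = "(\<integral>z. \<bar>h z\<bar> \<partial>\<rho>) * sqrt B"])
  fix g g' assume "g \<in> H" "g' \<in> H"
  then show "(\<integral>z. h z * (g (fst z) + g' (fst z)) \<partial>\<rho>)
      = (\<integral>z. h z * g (fst z) \<partial>\<rho>) + (\<integral>z. h z * g' (fst z) \<partial>\<rho>)"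
    using h by (simp add: distrib_left integrable_times_mem)
next
  fix a g assume "g \<in> H"
  then show "(\<integral>z. h z * (a * g (fst z)) \<partial>\<rho>) = a * (\<integral>z. h z * g (fst z) \<partial>\<rho>)"
    by (simp add: mult.left_commute)
next
  fix g assume g: "g \<in> H"
  have "\<bar>\<integral>z. h z * g (fst z) \<partial>\<rho>\<bar> \<le> (\<integral>z. \<bar>h z * g (fst z)\<bar> \<partial>\<rho>)"
    by (rule integral_abs_bound)
  also have "\<dots> \<le> (\<integral>z. \<bar>h z\<bar> * (sqrt B * nrm g) \<partial>\<rho>)"
    using h g mem_bound[OF g]
    by (intro integral_mono integrable_abs integrable_times_mem integrable_mult_left)
      (auto simp: abs_mult intro: mult_left_mono)
  also have "\<dots> = (\<integral>z. \<bar>h z\<bar> \<partial>\<rho>) * sqrt B * nrm g" by (simp add: mult.assoc)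
  finally show "\<bar>\<integral>z. h z * g (fst z) \<partial>\<rho>\<bar> \<le> (\<integral>z. \<bar>h z\<bar> \<partial>\<rho>) * sqrt B * nrm g" .
qed (rule that)

text \<open>
  This is the weak law of large numbers in \<open>H\<close>: the estimator with weights \<open>h(X\<^sub>i, f\<^sub>i)\<close> is the average
  of \<open>n\<close> independent copies of \<open>h(X, f) k(\<cdot>, X)\<close>, which has mean \<open>\<mu>\<close> and squared norm
  \<open>h(X, f)\<^sup>2 k(X, X)\<close>. When the square is expanded, independence turns each off-diagonal term into
  \<open>\<parallel>\<mu>\<parallel>\<^sup>2\<close>, and only the \<open>n\<close> diagonal terms contribute to the variance.
\<close>

lemma kernel_average_variance:
  fixes M :: "'w measure"
  assumes sample: "iid_sample M \<rho> n X f" and n: "n \<ge> 1"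
    and h [measurable]: "h \<in> borel_measurable (borel \<Otimes>\<^sub>M borel)"
    and h_square: "integrable \<rho> (\<lambda>z. (h z)\<^sup>2)"
    and \<mu>: "\<mu> \<in> H" "\<And>g. g \<in> H \<Longrightarrow> ip \<mu> g = (\<integral>z. h z * g (fst z) \<partial>\<rho>)"
  defines "err \<equiv> \<lambda>\<omega>. (nrm (\<lambda>t. \<mu> t - estimator k n (\<lambda>i. X i \<omega>) (\<lambda>i. h (X i \<omega>, f i \<omega>)) t))\<^sup>2"
  shows "integrable M err" "(\<integral>\<omega>. err \<omega> \<partial>M) \<le> B * (\<integral>z. (h z)\<^sup>2 \<partial>\<rho>) / real n"
proof -
  define S where "S = (borel \<Otimes>\<^sub>M borel :: ('x \<times> real) measure)"
  define Z where "Z i \<omega> = (X i \<omega>, f i \<omega>)" for i \<omega>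
  interpret M: prob_space M using sample by (simp add: iid_sample_def)
  have indep: "M.indep_vars (\<lambda>_. S) Z {1..n}"
    using sample by (simp add: iid_sample_def S_def Z_def[abs_def])
  have Z_meas [measurable]: "Z i \<in> measurable M S" if "i \<in> {1..n}" for i
    using indep that unfolding M.indep_vars_def by blast
  have Z_law: "distr M S (Z i) = \<rho>" if "i \<in> {1..n}" for i
    using sample that by (simp add: iid_sample_def S_def Z_def[abs_def])
  have one: "(integrable M (\<lambda>\<omega>. \<phi> (Z i \<omega>)) \<longleftrightarrow> integrable \<rho> \<phi>)
      \<and> (\<integral>\<omega>. \<phi> (Z i \<omega>) \<partial>M) = (\<integral>z. \<phi> z \<partial>\<rho>)"
    if "i \<in> {1..n}" "\<phi> \<in> borel_measurable S" for i and \<phi> :: "'x \<times> real \<Rightarrow> real"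
    using integrable_distr_eq[OF Z_meas[OF that(1)] that(2)] integral_distr[OF Z_meas[OF that(1)] that(2)]
    by (simp add: Z_law[OF that(1)])
  have pair_law: "distr M (S \<Otimes>\<^sub>M S) (\<lambda>\<omega>. (Z i \<omega>, Z j \<omega>)) = \<rho> \<Otimes>\<^sub>M \<rho>"
    if ij: "i \<in> {1..n}" "j \<in> {1..n}" "i \<noteq> j" for i j
  proof -
    have "M.indep_var (PiM {i} (\<lambda>_. S)) (\<lambda>\<omega>. restrict (\<lambda>i. Z i \<omega>) {i})
        (PiM {j} (\<lambda>_. S)) (\<lambda>\<omega>. restrict (\<lambda>i. Z i \<omega>) {j})"
      using ij by (intro M.indep_var_restrict[OF indep]) auto
    then have "M.indep_var S ((\<lambda>p. p i) \<circ> (\<lambda>\<omega>. restrict (\<lambda>i. Z i \<omega>) {i}))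
        S ((\<lambda>p. p j) \<circ> (\<lambda>\<omega>. restrict (\<lambda>i. Z i \<omega>) {j}))"
      by (rule M.indep_var_compose) (auto intro: measurable_component_singleton)
    then have "M.indep_var S (Z i) S (Z j)" by (simp add: comp_def)
    then show ?thesis using M.indep_var_distribution_eq[of S "Z i" S "Z j"] Z_law ij by simp
  qed
  have \<mu>_meas [measurable]: "\<mu> \<in> borel_measurable borel" using \<mu>(1) by (rule mem_measurable)
  have h_int: "integrable \<rho> h"
    by (rule law.square_integrable_imp_integrable[OF _ h_square]) measurable
  have B: "B \<ge> 0" using k_bound[of undefined undefined] by linarith
  define G where "G i j \<omega> = h (Z i \<omega>) * h (Z j \<omega>) * k (X i \<omega>) (X j \<omega>)" for i j \<omega>
  have X_eq: "X i \<omega> = fst (Z i \<omega>)" for i \<omega> by (simp add: Z_def)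
  have hS [measurable]: "h \<in> borel_measurable S" by (simp add: S_def)
  have fstS [measurable]: "fst \<in> measurable S borel" by (simp add: S_def)
  have G_meas [measurable]: "G i j \<in> borel_measurable M" if "i \<in> {1..n}" "j \<in> {1..n}" for i j
    unfolding G_def[abs_def] X_eq using that by measurable
  have G_int: "integrable M (G i j)" if "i \<in> {1..n}" "j \<in> {1..n}" for i j
  proof (rule Bochner_Integration.integrable_bound)
    show "integrable M (\<lambda>\<omega>. B * ((h (Z i \<omega>))\<^sup>2 + (h (Z j \<omega>))\<^sup>2))"
      using one[OF that(1), of "\<lambda>z. (h z)\<^sup>2"] one[OF that(2), of "\<lambda>z. (h z)\<^sup>2"] h_square by simp
    have "\<bar>a * b * c\<bar> \<le> B * (a\<^sup>2 + b\<^sup>2)" if "\<bar>c\<bar> \<le> B" for a b c :: real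
    proof -
      have "2 * \<bar>a * b\<bar> \<le> a\<^sup>2 + b\<^sup>2"
        using sum_squares_bound[of "\<bar>a\<bar>" "\<bar>b\<bar>"] by (simp add: abs_mult)
      then have "\<bar>a * b\<bar> \<le> a\<^sup>2 + b\<^sup>2" using abs_ge_zero[of "a * b"] by linarith
      then have "\<bar>a * b\<bar> * \<bar>c\<bar> \<le> (a\<^sup>2 + b\<^sup>2) * B" using that by (intro mult_mono) auto
      then show ?thesis by (simp add: abs_mult mult.commute)
    qed
    from this[OF k_bound] show "AE \<omega> in M. norm (G i j \<omega>) \<le> norm (B * ((h (Z i \<omega>))\<^sup>2 + (h (Z j \<omega>))\<^sup>2))"
      using B by (simp add: G_def)
  qed (use that in measurable)
  (* by Fubini, integrating out the second pair leaves mu at the first point *)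
  have G_offdiag: "(\<integral>\<omega>. G i j \<omega> \<partial>M) = ip \<mu> \<mu>" if ij: "i \<in> {1..n}" "j \<in> {1..n}" "i \<noteq> j" for i j
  proof -
    define \<Phi> where "\<Phi> = (\<lambda>(z, z'). h z * h z' * k (fst z) (fst z'))"
    have \<Phi>_meas: "\<Phi> \<in> borel_measurable (S \<Otimes>\<^sub>M S)" unfolding \<Phi>_def by measurable
    have pair_meas: "(\<lambda>\<omega>. (Z i \<omega>, Z j \<omega>)) \<in> measurable M (S \<Otimes>\<^sub>M S)" using ij by measurable
    have G_\<Phi>: "G i j = (\<lambda>\<omega>. \<Phi> (Z i \<omega>, Z j \<omega>))" by (simp add: G_def[abs_def] \<Phi>_def X_eq)
    interpret pair: pair_prob_space \<rho> \<rho> ..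
    have \<Phi>_int: "integrable (\<rho> \<Otimes>\<^sub>M \<rho>) \<Phi>"
      using integrable_distr_eq[OF pair_meas \<Phi>_meas] G_int[OF ij(1,2)]
      by (simp add: pair_law[OF ij] G_\<Phi>)
    have "(\<integral>\<omega>. G i j \<omega> \<partial>M) = (\<integral>p. \<Phi> p \<partial>(\<rho> \<Otimes>\<^sub>M \<rho>))"
      using integral_distr[OF pair_meas \<Phi>_meas] by (simp add: pair_law[OF ij] G_\<Phi>)
    also have "\<dots> = (\<integral>z. (\<integral>z'. \<Phi> (z, z') \<partial>\<rho>) \<partial>\<rho>)"
      by (rule pair.integral_fst'[OF \<Phi>_int, symmetric])
    also have "\<dots> = (\<integral>z. h z * \<mu> (fst z) \<partial>\<rho>)"
    proof -
      have "(\<integral>z'. \<Phi> (z, z') \<partial>\<rho>) = h z * (\<integral>z'. h z' * k (fst z') (fst z) \<partial>\<rho>)" for z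
        by (simp add: \<Phi>_def mult.assoc kernel_sym[of "fst z"])
      then show ?thesis
        using \<mu>(2)[OF kernel_mem] reproducing[OF \<mu>(1)] by simp
    qed
    also have "\<dots> = ip \<mu> \<mu>" using \<mu> by simp
    finally show ?thesis .
  qed
  have G_diag: "(\<integral>\<omega>. G i i \<omega> \<partial>M) \<le> B * (\<integral>z. (h z)\<^sup>2 \<partial>\<rho>)" if i: "i \<in> {1..n}" for i
  proof -
    have sq: "integrable M (\<lambda>\<omega>. (h (Z i \<omega>))\<^sup>2)" "(\<integral>\<omega>. (h (Z i \<omega>))\<^sup>2 \<partial>M) = (\<integral>z. (h z)\<^sup>2 \<partial>\<rho>)"
      using one[OF i, of "\<lambda>z. (h z)\<^sup>2"] h_square by auto
    have "G i i \<omega> \<le> B * (h (Z i \<omega>))\<^sup>2" for \<omega>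
      using mult_right_mono[of "k (X i \<omega>) (X i \<omega>)" B "(h (Z i \<omega>))\<^sup>2"] k_bound[of "X i \<omega>" "X i \<omega>"]
      by (simp add: G_def power2_eq_square mult_ac)
    then have "(\<integral>\<omega>. G i i \<omega> \<partial>M) \<le> (\<integral>\<omega>. B * (h (Z i \<omega>))\<^sup>2 \<partial>M)"
      using sq(1) G_int[OF i i] by (intro integral_mono) auto
    then show ?thesis using sq by simp
  qed
  have lin: "integrable M (\<lambda>\<omega>. h (Z i \<omega>) * \<mu> (X i \<omega>))" "(\<integral>\<omega>. h (Z i \<omega>) * \<mu> (X i \<omega>) \<partial>M) = ip \<mu> \<mu>"
    if i: "i \<in> {1..n}" for i
    using one[OF i, of "\<lambda>z. h z * \<mu> (fst z)"] integrable_times_mem[OF h_int \<mu>(1)] \<mu> by (auto simp: X_eq)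
  have err_eq: "err = (\<lambda>\<omega>. ip \<mu> \<mu> - (2 / real n) * (\<Sum>i=1..n. h (Z i \<omega>) * \<mu> (X i \<omega>))
      + (1 / (real n)\<^sup>2) * (\<Sum>i=1..n. \<Sum>j=1..n. G i j \<omega>))"
    by (simp add: err_def estimator_error_square[OF \<mu>(1)] G_def Z_def)
  have "integrable M (\<lambda>\<omega>. (\<Sum>i=1..n. h (Z i \<omega>) * \<mu> (X i \<omega>)))"
    "integrable M (\<lambda>\<omega>. (\<Sum>i=1..n. \<Sum>j=1..n. G i j \<omega>))"
    by (intro Bochner_Integration.integrable_sum lin G_int; simp)+
  note ints = this
  show "integrable M err"
    unfolding err_eq by (intro Bochner_Integration.integrable_add Bochner_Integration.integrable_diff
        integrable_mult_right ints) simp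
  define b where "b = B * (\<integral>z. (h z)\<^sup>2 \<partial>\<rho>)"
  have "(\<integral>\<omega>. (\<Sum>i=1..n. \<Sum>j=1..n. G i j \<omega>) \<partial>M) = (\<Sum>i=1..n. (\<integral>\<omega>. (\<Sum>j=1..n. G i j \<omega>) \<partial>M))"
    by (intro Bochner_Integration.integral_sum Bochner_Integration.integrable_sum G_int)
  also have "\<dots> = (\<Sum>i=1..n. \<Sum>j=1..n. (\<integral>\<omega>. G i j \<omega> \<partial>M))"
    by (intro sum.cong refl Bochner_Integration.integral_sum G_int)
  also have "\<dots> \<le> (\<Sum>i=1..n. \<Sum>j=1..n. ip \<mu> \<mu> + (if j = i then b - ip \<mu> \<mu> else 0))"
    using G_diag G_offdiag by (intro sum_mono) (auto simp: b_def)
  also have "\<dots> = (real n)\<^sup>2 * ip \<mu> \<mu> + real n * (b - ip \<mu> \<mu>)"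
    by (simp add: sum.distrib power2_eq_square algebra_simps)
  finally have sum_G: "(\<integral>\<omega>. (\<Sum>i=1..n. \<Sum>j=1..n. G i j \<omega>) \<partial>M)
      \<le> (real n)\<^sup>2 * ip \<mu> \<mu> + real n * (b - ip \<mu> \<mu>)" .
  have "(\<integral>\<omega>. (\<Sum>i=1..n. h (Z i \<omega>) * \<mu> (X i \<omega>)) \<partial>M) = (\<Sum>i=1..n. (\<integral>\<omega>. h (Z i \<omega>) * \<mu> (X i \<omega>) \<partial>M))"
    by (intro Bochner_Integration.integral_sum lin)
  also have "\<dots> = (\<Sum>i=1..n. ip \<mu> \<mu>)" by (intro sum.cong refl lin)
  finally have sum_lin: "(\<integral>\<omega>. (\<Sum>i=1..n. h (Z i \<omega>) * \<mu> (X i \<omega>)) \<partial>M) = real n * ip \<mu> \<mu>" by simp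
  have "(\<integral>\<omega>. err \<omega> \<partial>M) = ip \<mu> \<mu> - (2 / real n) * (\<integral>\<omega>. (\<Sum>i=1..n. h (Z i \<omega>) * \<mu> (X i \<omega>)) \<partial>M)
      + (1 / (real n)\<^sup>2) * (\<integral>\<omega>. (\<Sum>i=1..n. \<Sum>j=1..n. G i j \<omega>) \<partial>M)"
    unfolding err_eq using ints by (simp add: M.prob_space)
  also note sum_lin
  also have "ip \<mu> \<mu> - (2 / real n) * (real n * ip \<mu> \<mu>)
        + (1 / (real n)\<^sup>2) * (\<integral>\<omega>. (\<Sum>i=1..n. \<Sum>j=1..n. G i j \<omega>) \<partial>M)
      \<le> ip \<mu> \<mu> - (2 / real n) * (real n * ip \<mu> \<mu>)
        + (1 / (real n)\<^sup>2) * ((real n)\<^sup>2 * ip \<mu> \<mu> + real n * (b - ip \<mu> \<mu>))"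
    by (intro add_left_mono mult_left_mono sum_G) simp
  also have "\<dots> = (b - ip \<mu> \<mu>) / real n"
    using n by (simp add: field_simps power2_eq_square)
  also have "\<dots> \<le> b / real n" using ip_ge_zero[OF \<mu>(1)] by (intro divide_right_mono) auto
  finally show "(\<integral>\<omega>. err \<omega> \<partial>M) \<le> B * (\<integral>z. (h z)\<^sup>2 \<partial>\<rho>) / real n" by (simp add: b_def)
qed

text \<open>
  The matrix \<open>lam I + G / n\<close>, with \<open>G\<close> the Gram matrix, is coercive with constant \<open>lam\<close> because \<open>G\<close> is
  positive semidefinite, and its entries are bounded uniformly in the sample.
\<close>

lemma weights_measurable:
  fixes M :: "'w measure"
  assumes X: "\<And>i. i \<in> {1..n} \<Longrightarrow> X i \<in> borel_measurable M"
    and f: "\<And>i. i \<in> {1..n} \<Longrightarrow> f i \<in> borel_measurable M"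
    and lam: "lam > 0"
    and w: "\<And>\<omega>. \<omega> \<in> space M \<Longrightarrow> solves_weights k lam n (\<lambda>i. X i \<omega>) (\<lambda>i. f i \<omega>) (\<lambda>i. w i \<omega>)"
    and i: "i \<in> {1..n}"
  shows "w i \<in> borel_measurable M"
proof -
  define A where "A i j \<omega> = (if i = j then lam else 0) + (1 / real n) * k (X i \<omega>) (X j \<omega>)" for i j \<omega>
  have A_apply: "(\<Sum>j=1..n. A i j \<omega> * v j) = lam * v i + (1 / real n) * (\<Sum>j=1..n. k (X i \<omega>) (X j \<omega>) * v j)"
    if "i \<in> {1..n}" for i \<omega> v
  proof -
    have "(\<Sum>j=1..n. (if i = j then lam else 0) * v j) = lam * v i"
      using that by (simp add: if_distrib[of "\<lambda>c. c * _"] cong: if_cong)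
    then show ?thesis
      by (simp add: A_def distrib_right sum.distrib sum_distrib_left mult.assoc)
  qed
  show ?thesis
  proof (rule coercive_system_solution_measurable[where I = "{1..n}" and A = A and y = f
        and b = "lam + B / real n" and c = lam])
    fix i j assume ij: "i \<in> {1..n}" "j \<in> {1..n}"
    have [measurable]: "X i \<in> borel_measurable M" "X j \<in> borel_measurable M" using X ij by auto
    show "A i j \<in> borel_measurable M" unfolding A_def[abs_def] by measurable
    fix \<omega>
    have "\<bar>A i j \<omega>\<bar> \<le> \<bar>if i = j then lam else 0\<bar> + \<bar>(1 / real n) * k (X i \<omega>) (X j \<omega>)\<bar>"
      unfolding A_def by (rule abs_triangle_ineq)
    also have "\<bar>(1 / real n) * k (X i \<omega>) (X j \<omega>)\<bar> \<le> B / real n"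
      using divide_right_mono[OF k_bound[of "X i \<omega>" "X j \<omega>"], of "real n"] by (simp add: abs_mult)
    finally show "\<bar>A i j \<omega>\<bar> \<le> lam + B / real n" using lam by (simp split: if_splits)
  next
    fix v :: "nat \<Rightarrow> real" and \<omega>
    have "(\<Sum>i=1..n. v i * (\<Sum>j=1..n. A i j \<omega> * v j))
        = (\<Sum>i=1..n. v i * (lam * v i + (1 / real n) * (\<Sum>j=1..n. k (X i \<omega>) (X j \<omega>) * v j)))"
      by (intro sum.cong refl arg_cong2[where f = "(*)"] A_apply)
    also have "\<dots> = lam * (\<Sum>i=1..n. (v i)\<^sup>2)
          + (1 / real n) * (\<Sum>i=1..n. v i * (\<Sum>j=1..n. k (X i \<omega>) (X j \<omega>) * v j))"
      by (simp only: distrib_left sum.distrib sum_distrib_left[of _ _ "{1..n}"] power2_eq_square mult_ac)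
    finally show "lam * (\<Sum>i=1..n. (v i)\<^sup>2) \<le> (\<Sum>i=1..n. v i * (\<Sum>j=1..n. A i j \<omega> * v j))"
      using gram_psd[where v = v and n = n and x = "\<lambda>i. X i \<omega>"] by simp
  next
    fix i \<omega> assume "i \<in> {1..n}" "\<omega> \<in> space M"
    then show "(\<Sum>j=1..n. A i j \<omega> * w j \<omega>) = f i \<omega>"
      using w[of \<omega>] unfolding solves_weights_def by (simp only: A_apply)
  qed (use i lam f in simp_all)
qed

text \<open>
  Testing the defining property of the conditional expectation with \<open>g(X)\<close>, which is measurable with
  respect to the \<open>\<sigma>\<close>-algebra generated by \<open>X\<close>, shows that the noise \<open>f - f0(X)\<close> has mean embedding
  zero.
\<close>

lemma regression_residual_orthogonal:
  assumes f: "integrable \<rho> snd" and f0: "regression_function \<rho> f0" "f0 \<in> H" and g: "g \<in> H"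
  shows "(\<integral>z. (snd z - f0 (fst z)) * g (fst z) \<partial>\<rho>) = 0"
proof -
  define F where "F = vimage_algebra (space \<rho>) fst (borel :: 'x measure)"
  have fst_F: "fst \<in> measurable F borel"
    unfolding F_def by (rule measurable_vimage_algebra1) simp
  have "sets F \<subseteq> sets \<rho>"
  proof -
    have "fst \<in> measurable \<rho> (borel :: 'x measure)" by measurable
    then show ?thesis unfolding F_def by (auto simp: sets_vimage_algebra2 dest: measurable_sets)
  qed
  then have "subalgebra \<rho> F" by (simp add: subalgebra_def F_def)
  then interpret F: finite_measure_subalgebra \<rho> F by unfold_locales
  have [measurable]: "g \<in> borel_measurable borel" "f0 \<in> borel_measurable borel"
    using g f0(2) mem_measurable by auto
  have g_F: "(\<lambda>z. g (fst z)) \<in> borel_measurable F" using fst_F by measurable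
  have fg: "integrable \<rho> (\<lambda>z. g (fst z) * snd z)"
    using integrable_times_mem[OF f g] by (simp add: mult.commute)
  have "integrable \<rho> (\<lambda>z. f0 (fst z))"
    using integrable_times_mem[OF _ f0(2), of "\<lambda>_. 1"] by simp
  from integrable_times_mem[OF this g] have f0g: "integrable \<rho> (\<lambda>z. g (fst z) * f0 (fst z))"
    by (simp add: mult.commute)
  have "(\<integral>z. g (fst z) * f0 (fst z) \<partial>\<rho>) = (\<integral>z. g (fst z) * real_cond_exp \<rho> F snd z \<partial>\<rho>)"
  proof (rule integral_cong_AE)
    show "AE z in \<rho>. g (fst z) * f0 (fst z) = g (fst z) * real_cond_exp \<rho> F snd z"
      using f0(1) unfolding regression_function_def F_def by auto
  qed measurable
  also have "\<dots> = (\<integral>z. g (fst z) * snd z \<partial>\<rho>)"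
    by (rule F.real_cond_exp_intg(2)[OF fg g_F]) measurable
  finally have "(\<integral>z. g (fst z) * snd z - g (fst z) * f0 (fst z) \<partial>\<rho>) = 0"
    using fg f0g by simp
  then show ?thesis by (simp add: right_diff_distrib mult.commute[of _ "g _"])
qed

end

section \<open>The error bound\<close>

theorem theorem6p3:
  fixes k :: "'x::topological_space \<Rightarrow> 'x \<Rightarrow> real"
    and H :: "('x \<Rightarrow> real) set"
    and ip :: "('x \<Rightarrow> real) \<Rightarrow> ('x \<Rightarrow> real) \<Rightarrow> real"
    and \<rho> :: "('x \<times> real) measure"
    and f0 w0 :: "'x \<Rightarrow> real"
  assumes kernel: "psd_kernel k"
    and k_continuous: "continuous_on UNIV (\<lambda>(x, y). k x y)"
    and k_measurable: "(\<lambda>(x, y). k x y) \<in> borel_measurable (borel \<Otimes>\<^sub>M borel)"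
    and k_bounded: "bounded (range (\<lambda>(x, y). k x y))"
    and rkhs: "rkhs k H ip"
    and rho_sets: "sets \<rho> = sets (borel \<Otimes>\<^sub>M borel)"
    and rho_prob: "prob_space \<rho>"
    and f_square_integrable: "integrable \<rho> (\<lambda>z. (snd z)\<^sup>2)"
    and f0_regression: "regression_function \<rho> f0"
    and w0: "w0 \<in> H"
    and f0_eq: "f0 = kernel_operator k (design_law \<rho>) w0"
  shows "f0 \<in> H \<and>
    (\<exists>C0 C1 C2 :: real. \<forall>lam>0. \<forall>n\<ge>1.
      \<forall>(M :: 'w measure) (X :: nat \<Rightarrow> 'w \<Rightarrow> 'x) (f :: nat \<Rightarrow> 'w \<Rightarrow> real) (w :: nat \<Rightarrow> 'w \<Rightarrow> real).
        iid_sample M \<rho> n X f \<longrightarrow>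
        (\<forall>\<omega>\<in>space M. solves_weights k lam n (\<lambda>i. X i \<omega>) (\<lambda>i. f i \<omega>) (\<lambda>i. w i \<omega>)) \<longrightarrow>
        (let err = (\<lambda>\<omega>. (ip_norm ip (\<lambda>t. f0 t - estimator k n (\<lambda>i. X i \<omega>) (\<lambda>i. w i \<omega>) t))\<^sup>2)
         in integrable M err \<and>
            prob_space.expectation M err
              \<le> 2 * C0 * lam\<^sup>2 + 4 * C1 / (lam\<^sup>2 * real n) + C2 / (lam ^ 3 * real n)))"
proof -
  interpret rkhs k H ip by (rule rkhs)
  obtain B where B: "\<And>x y. \<bar>k x y\<bar> \<le> B"
    using k_bounded by (auto simp: bounded_iff)
  interpret kernel_design k H ip \<rho> B
  proof (intro kernel_design.intro rkhs rho_prob kernel_design_axioms.intro k_measurable B rho_sets)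
    fix g assume "g \<in> H"
    then show "g \<in> borel_measurable borel"
      by (intro borel_measurable_continuous_onI rkhs_continuous[OF rkhs k_continuous])
  qed
  have [measurable]: "w0 \<in> borel_measurable borel" by (rule mem_measurable[OF w0])
  have mem_square_integrable: "integrable \<rho> (\<lambda>z. (g (fst z))\<^sup>2)" if g: "g \<in> H" for g
  proof -
    have "integrable \<rho> (\<lambda>z. g (fst z))" using integrable_times_mem[OF _ g, of "\<lambda>_. 1"] by simp
    from integrable_times_mem[OF this g] show ?thesis by (simp add: power2_eq_square)
  qed
  have w0_int: "integrable \<rho> (\<lambda>z. w0 (fst z))"
    using integrable_times_mem[OF _ w0, of "\<lambda>_. 1"] by simp
  obtain \<mu> where \<mu>: "\<mu> \<in> H" "\<And>g. g \<in> H \<Longrightarrow> ip \<mu> g = (\<integral>z. w0 (fst z) * g (fst z) \<partial>\<rho>)"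
    by (rule mean_embedding[OF w0_int]) (rule that)
  (* K w0 is the mean embedding of w0(X): evaluate the representer at x by the reproducing property *)
  have "f0 x = \<mu> x" for x
  proof -
    have "f0 x = (\<integral>y. k x y * w0 y \<partial>distr \<rho> borel fst)"
      by (simp add: f0_eq kernel_operator_def design_law_def)
    also have "\<dots> = (\<integral>z. w0 (fst z) * k (fst z) x \<partial>\<rho>)"
      by (subst integral_distr) (auto simp: mult.commute kernel_sym[of x])
    also have "\<dots> = ip \<mu> (\<lambda>t. k t x)" by (simp add: \<mu>(2)[OF kernel_mem])
    also have "\<dots> = \<mu> x" by (rule reproducing[OF \<mu>(1)])
    finally show ?thesis .
  qed
  then have "f0 = \<mu>" ..
  then have f0_mem: "f0 \<in> H" and ip_f0: "\<And>g. g \<in> H \<Longrightarrow> ip f0 g = (\<integral>z. w0 (fst z) * g (fst z) \<partial>\<rho>)"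
    using \<mu> by simp_all
  have [measurable]: "f0 \<in> borel_measurable borel" by (rule mem_measurable[OF f0_mem])
  define \<epsilon> where "\<epsilon> z = snd z - f0 (fst z)" for z
  have \<epsilon>_meas: "\<epsilon> \<in> borel_measurable (borel \<Otimes>\<^sub>M borel)" unfolding \<epsilon>_def[abs_def] by measurable
  have f_int: "integrable \<rho> snd"
    by (rule law.square_integrable_imp_integrable[OF _ f_square_integrable]) measurable
  have \<epsilon>_square: "integrable \<rho> (\<lambda>z. (\<epsilon> z)\<^sup>2)"
  proof -
    have "integrable \<rho> (\<lambda>z. (snd z)\<^sup>2 - 2 * (snd z * f0 (fst z)) + (f0 (fst z))\<^sup>2)"
      using f_square_integrable integrable_times_mem[OF f_int f0_mem] mem_square_integrable[OF f0_mem]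
      by simp
    then show ?thesis by (simp add: \<epsilon>_def power2_diff mult.assoc algebra_simps)
  qed
  have \<epsilon>_mean: "ip (\<lambda>_. 0) g = (\<integral>z. \<epsilon> z * g (fst z) \<partial>\<rho>)" if "g \<in> H" for g
    using regression_residual_orthogonal[OF f_int f0_regression f0_mem that] ip_zero_left[OF that]
    by (simp add: \<epsilon>_def)
  define S1 where "S1 = B * (\<integral>z. (\<epsilon> z)\<^sup>2 \<partial>\<rho>)"
  define S2 where "S2 = B * (\<integral>z. (w0 (fst z))\<^sup>2 \<partial>\<rho>)"
  define C0 where "C0 = 6 * (nrm w0)\<^sup>2 + 3 / 2 * S2"
  define C1 where "C1 = 3 / 4 * (S1 + S2)"
  have S2: "0 \<le> S2"
  proof -
    have "0 \<le> B" using B[of undefined undefined] by linarith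
    then show ?thesis by (simp add: S2_def)
  qed
  (* no term of order 1 / (lam^3 n) arises, so C2 is instantiated with 0 *)
  have main: "let err = (\<lambda>\<omega>. (nrm (\<lambda>t. f0 t - estimator k n (\<lambda>i. X i \<omega>) (\<lambda>i. w i \<omega>) t))\<^sup>2)
         in integrable M err \<and>
            prob_space.expectation M err
              \<le> 2 * C0 * lam\<^sup>2 + 4 * C1 / (lam\<^sup>2 * real n) + 0 / (lam ^ 3 * real n)"
    if lam: "lam > 0" and n: "n \<ge> 1" and sample: "iid_sample M \<rho> n X f"
      and w: "\<forall>\<omega>\<in>space M. solves_weights k lam n (\<lambda>i. X i \<omega>) (\<lambda>i. f i \<omega>) (\<lambda>i. w i \<omega>)"
    for lam n and M :: "'w measure" and X :: "nat \<Rightarrow> 'w \<Rightarrow> 'x" and f w :: "nat \<Rightarrow> 'w \<Rightarrow> real"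
  proof -
    interpret M: prob_space M using sample by (simp add: iid_sample_def)
    define err where "err \<omega> = (nrm (\<lambda>t. f0 t - estimator k n (\<lambda>i. X i \<omega>) (\<lambda>i. w i \<omega>) t))\<^sup>2" for \<omega>
    define noise where
      "noise \<omega> = (nrm (estimator k n (\<lambda>i. X i \<omega>) (\<lambda>i. f i \<omega> - f0 (X i \<omega>))))\<^sup>2" for \<omega>
    define sampling where
      "sampling \<omega> = (nrm (\<lambda>t. f0 t - estimator k n (\<lambda>i. X i \<omega>) (\<lambda>i. w0 (X i \<omega>)) t))\<^sup>2" for \<omega>
    have noise: "integrable M noise" "(\<integral>\<omega>. noise \<omega> \<partial>M) \<le> S1 / n"
    proof -
      have "(nrm (\<lambda>t. 0 - estimator k n (\<lambda>i. X i \<omega>) (\<lambda>i. \<epsilon> (X i \<omega>, f i \<omega>)) t))\<^sup>2 = noise \<omega>" for \<omega>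
        using nrm_scale[OF estimator_mem, of "-1"] by (simp add: noise_def \<epsilon>_def)
      then show "integrable M noise" "(\<integral>\<omega>. noise \<omega> \<partial>M) \<le> S1 / n"
        using kernel_average_variance[OF sample n \<epsilon>_meas \<epsilon>_square zero_mem \<epsilon>_mean]
        by (simp_all add: S1_def)
    qed
    have sampling: "integrable M sampling" "(\<integral>\<omega>. sampling \<omega> \<partial>M) \<le> S2 / n"
      using kernel_average_variance[OF sample n _ mem_square_integrable[OF w0] f0_mem ip_f0]
      by (simp_all add: sampling_def[abs_def] S2_def)
    have "(\<lambda>\<omega>. (X i \<omega>, f i \<omega>)) \<in> measurable M (borel \<Otimes>\<^sub>M borel)" if "i \<in> {1..n}" for i
      using sample that unfolding iid_sample_def M.indep_vars_def by blast
    from measurable_compose[OF this measurable_fst] measurable_compose[OF this measurable_snd]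
    have X_meas: "\<And>i. i \<in> {1..n} \<Longrightarrow> X i \<in> borel_measurable M"
      and f_meas: "\<And>i. i \<in> {1..n} \<Longrightarrow> f i \<in> borel_measurable M" by simp_all
    have w_meas: "w i \<in> borel_measurable M" if "i \<in> {1..n}" for i
      by (rule weights_measurable[where X = X and f = f and n = n, OF X_meas f_meas lam _ that])
        (use w in auto)
    have err_meas: "err \<in> borel_measurable M"
    proof -
      note [measurable] = X_meas w_meas
      show ?thesis
        unfolding err_def[abs_def] estimator_error_square[OF f0_mem] by measurable
    qed
    define bound where
      "bound \<omega> = 3 / lam\<^sup>2 * noise \<omega> + 3 * sampling \<omega> + 12 * lam\<^sup>2 * (nrm w0)\<^sup>2" for \<omega>
    have bound_int: "integrable M bound" unfolding bound_def[abs_def] using noise sampling by simp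
    have err_le: "err \<omega> \<le> bound \<omega>" if \<omega>: "\<omega> \<in> space M" for \<omega>
    proof -
      have square3: "(a + b + c)\<^sup>2 \<le> 3 * a\<^sup>2 + 3 * b\<^sup>2 + 3 * c\<^sup>2" for a b c :: real
        using sum_squares_bound[of a b] sum_squares_bound[of b c] sum_squares_bound[of a c]
        by (simp add: power2_eq_square algebra_simps)
      let ?\<xi> = "nrm (estimator k n (\<lambda>i. X i \<omega>) (\<lambda>i. f i \<omega> - f0 (X i \<omega>)))"
      let ?D = "nrm (\<lambda>t. f0 t - estimator k n (\<lambda>i. X i \<omega>) (\<lambda>i. w0 (X i \<omega>)) t)"
      have "err \<omega> \<le> (?\<xi> / lam + ?D + 2 * lam * nrm w0)\<^sup>2"
        unfolding err_def using w \<omega>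
        by (intro power_mono estimator_error_decomposition f0_mem w0 lam nrm_nonneg diff_mem estimator_mem)
          auto
      also have "\<dots> \<le> 3 * (?\<xi> / lam)\<^sup>2 + 3 * ?D\<^sup>2 + 3 * (2 * lam * nrm w0)\<^sup>2" by (rule square3)
      also have "\<dots> = bound \<omega>"
        by (simp add: bound_def noise_def sampling_def power_divide power_mult_distrib)
      finally show ?thesis .
    qed
    have err_int: "integrable M err"
    proof (rule Bochner_Integration.integrable_bound[OF bound_int err_meas], rule AE_I2)
      fix \<omega> assume "\<omega> \<in> space M"
      moreover have "0 \<le> err \<omega>" by (simp add: err_def)
      ultimately show "norm (err \<omega>) \<le> norm (bound \<omega>)" using err_le[of \<omega>] by simp
    qed
    have "(\<integral>\<omega>. err \<omega> \<partial>M) \<le> (\<integral>\<omega>. bound \<omega> \<partial>M)"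
      by (intro integral_mono err_int bound_int err_le)
    also have "\<dots> = 3 / lam\<^sup>2 * (\<integral>\<omega>. noise \<omega> \<partial>M) + 3 * (\<integral>\<omega>. sampling \<omega> \<partial>M) + 12 * lam\<^sup>2 * (nrm w0)\<^sup>2"
      unfolding bound_def[abs_def] using noise sampling by (simp add: M.prob_space)
    also have "\<dots> \<le> 3 / lam\<^sup>2 * (S1 / n) + 3 * (S2 / n) + 12 * lam\<^sup>2 * (nrm w0)\<^sup>2"
      using noise sampling by (intro add_mono mult_left_mono) auto
    also have "\<dots> \<le> 3 / lam\<^sup>2 * (S1 / n) + 3 * (S2 * (lam\<^sup>2 + 1 / (lam\<^sup>2 * n))) + 12 * lam\<^sup>2 * (nrm w0)\<^sup>2"
    proof -
      (* the bound 1/n for the sampling error carries no power of lam: it is absorbed by lam^2 if lam >= 1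
         and by 1 / (lam^2 n) otherwise *)
      have "1 / real n \<le> lam\<^sup>2 + 1 / (lam\<^sup>2 * n)"
      proof (cases "lam \<ge> 1")
        case True
        then have "1 \<le> lam\<^sup>2" by simp
        moreover have "1 / real n \<le> 1" "0 \<le> 1 / (lam\<^sup>2 * n)" using n by auto
        ultimately show ?thesis by linarith
      next
        case False
        then have "lam\<^sup>2 * n \<le> 1 * real n"
          using lam by (intro mult_right_mono) (auto simp: power_le_one)
        then have "1 / real n \<le> 1 / (lam\<^sup>2 * n)"
          using lam n by (intro divide_left_mono) auto
        moreover have "0 \<le> lam\<^sup>2" by simp
        ultimately show ?thesis by linarith
      qed
      then have "S2 * (1 / n) \<le> S2 * (lam\<^sup>2 + 1 / (lam\<^sup>2 * n))" using S2 by (rule mult_left_mono)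
      then show ?thesis by simp
    qed
    also have "\<dots> = 2 * C0 * lam\<^sup>2 + 4 * C1 / (lam\<^sup>2 * real n)"
      using lam n by (simp add: C0_def C1_def field_simps)
    finally show ?thesis
      using err_int by (simp add: Let_def err_def[abs_def])
  qed
  show ?thesis
    using f0_mem main by blast
qed

end
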